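(* Let $(X,d)$ be a semimetric space with a triangle function $\Phi$ satisfying the following conditions: 1) $\Phi(ku,kv)=k\Phi(u,v)$ for all $k,u,v\in[0,\infty)$; 2) for every $0\leqslant\alpha<1$ there exists $C(\alpha)>0$ such that for every positive integer $p$ the inequality $$\Phi(1,\Phi(\alpha,\Phi(\alpha^2,\ldots,\Phi(\alpha^{p-1},\alpha^{p}))))\leqslant C(\alpha)$$ holds. Let $(x_n)$, $n=0,1,\ldots$, be a sequence in $X$ for which there exists $\alpha\in[0,1)$ such that $d(x_n,x_{n+1})\leqslant\alpha\, d(x_{n-1},x_n)$ for all $n\geqslant1$. Then $(x_n)$ is a Cauchy sequence.
   Context: Let $X$ be a nonempty set. A semimetric on $X$ is a map $d\colon X\times X\to[0,\infty)$ such that $d(x,y)=0$ if and only if $x=y$, and $d(x,y)=d(y,x)$ for all $x,y\in X$ (no triangle inequality is required). The pair $(X,d)$ is then called a semimetric space. A function $\Phi\colon[0,\infty)\times[0,\infty)\to[0,\infty)$ is a triangle function for $d$ if $\Phi$ is symmetric, nondecreasing in each of its arguments, $\Phi(0,0)=0$, and $d(x,y)\leqslant\Phi(d(x,z),d(z,y))$ for all $x,y,z\in X$. Cauchy sequences are defined as usual: $(x_n)$ is Cauchy if for every $\varepsilon>0$ there is $N$ with $d(x_n,x_m)<\varepsilon$ for all $n,m\geqslant N$. For $p=1$ the nested expression in condition 2) is $\Phi(1,\alpha)$, for $p=2$ it is $\Phi(1,\Phi(\alpha,\alpha^2))$, and so on (with $\alpha^0=1$). *)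

theory Defs
  imports Complex_Main
begin

locale semimetric_space =
  fixes X :: "'a set" and d :: "'a \<Rightarrow> 'a \<Rightarrow> real"
  assumes nonempty: "X \<noteq> {}"
    and nonneg: "\<lbrakk>x \<in> X; y \<in> X\<rbrakk> \<Longrightarrow> 0 \<le> d x y"
    and zero_iff: "\<lbrakk>x \<in> X; y \<in> X\<rbrakk> \<Longrightarrow> d x y = 0 \<longleftrightarrow> x = y"
    and commute: "\<lbrakk>x \<in> X; y \<in> X\<rbrakk> \<Longrightarrow> d x y = d y x"

(* A function [0,\<infinity>) \<times> [0,\<infinity>) \<rightarrow> [0,\<infinity>) is a curried function on the reals whose values
   outside the nonnegative quadrant are irrelevant; \<open>closed\<close> gives its codomain. *)
locale triangle_function = semimetric_space X d
  for X :: "'a set" and d :: "'a \<Rightarrow> 'a \<Rightarrow> real" +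
  fixes \<Phi> :: "real \<Rightarrow> real \<Rightarrow> real"
  assumes closed: "\<lbrakk>0 \<le> u; 0 \<le> v\<rbrakk> \<Longrightarrow> 0 \<le> \<Phi> u v"
    and symmetric: "\<lbrakk>0 \<le> u; 0 \<le> v\<rbrakk> \<Longrightarrow> \<Phi> u v = \<Phi> v u"
    and mono_left: "\<lbrakk>0 \<le> u; u \<le> u'; 0 \<le> v\<rbrakk> \<Longrightarrow> \<Phi> u v \<le> \<Phi> u' v"
    and mono_right: "\<lbrakk>0 \<le> u; 0 \<le> v; v \<le> v'\<rbrakk> \<Longrightarrow> \<Phi> u v \<le> \<Phi> u v'"
    and zero_zero: "\<Phi> 0 0 = 0"
    and triangle: "\<lbrakk>x \<in> X; y \<in> X; z \<in> X\<rbrakk> \<Longrightarrow> d x y \<le> \<Phi> (d x z) (d z y)"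

(* The library's Cauchy notions presuppose a metric, so the definition is repeated for
   an arbitrary distance function. *)
definition semimetric_Cauchy :: "('a \<Rightarrow> 'a \<Rightarrow> real) \<Rightarrow> (nat \<Rightarrow> 'a) \<Rightarrow> bool" where
  "semimetric_Cauchy d x \<longleftrightarrow> (\<forall>\<epsilon>>0. \<exists>N. \<forall>n\<ge>N. \<forall>m\<ge>N. d (x n) (x m) < \<epsilon>)"

(* \<Phi>(1, \<Phi>(\<alpha>, \<Phi>(\<alpha>^2, ..., \<Phi>(\<alpha>^(p-1), \<alpha>^p)))), with \<alpha>^0 = 1 also for \<alpha> = 0 *)
definition nested :: "(real \<Rightarrow> real \<Rightarrow> real) \<Rightarrow> real \<Rightarrow> nat \<Rightarrow> real" where
  "nested \<Phi> \<alpha> p = foldr (\<lambda>i. \<Phi> (\<alpha> ^ i)) [0..<p] (\<alpha> ^ p)"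

lemma nested_1: "nested \<Phi> \<alpha> 1 = \<Phi> 1 \<alpha>"
  by (simp add: nested_def)

lemma nested_2: "nested \<Phi> \<alpha> 2 = \<Phi> 1 (\<Phi> \<alpha> (\<alpha> ^ 2))"
  by (simp add: nested_def upt_rec)

end

(* Homogeneity turns the nested expression into the recursion
   N(p+1) = \<Phi>(1, \<alpha> N(p)), so splitting off the first step of the sequence gives
   d(x_n, x_{n+p+1}) \<le> \<alpha>^n d(x_0, x_1) N(p) by induction on p. Since N is bounded,
   the distances decay geometrically in n, uniformly in p. *)

theory Submission
  imports Defs
begin

context triangle_function
begin

lemma foldr_nonneg:
  assumes "\<And>i. 0 \<le> f i" "0 \<le> z"
  shows "0 \<le> foldr (\<lambda>i. \<Phi> (f i)) is z"
  by (induction "is") (simp_all add: assms closed)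

text \<open>The factor \<open>c\<close> is pulled out of one \<open>\<Phi>\<close> at a time,
  starting from the innermost. Homogeneity is available only for nonnegative arguments, so each
  stage needs \<open>foldr_nonneg\<close> for the inner fold.\<close>

lemma foldr_homogeneous:
  assumes hom: "\<And>k u v. \<lbrakk>0 \<le> k; 0 \<le> u; 0 \<le> v\<rbrakk> \<Longrightarrow> \<Phi> (k * u) (k * v) = k * \<Phi> u v"
    and "\<And>i. 0 \<le> f i" "0 \<le> z" "0 \<le> c"
  shows "foldr (\<lambda>i. \<Phi> (c * f i)) is (c * z) = c * foldr (\<lambda>i. \<Phi> (f i)) is z"
  by (induction "is") (simp_all add: assms foldr_nonneg)

lemma nested_nonneg: "0 \<le> \<alpha> \<Longrightarrow> 0 \<le> nested \<Phi> \<alpha> p"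
  unfolding nested_def by (rule foldr_nonneg) simp_all

text \<open>Below the outermost \<open>\<Phi>\<close> the exponents run from 1 to p + 1. Writing
  each power as \<alpha> times the preceding one turns this inner part into the expression for p
  scaled by \<alpha>.\<close>

lemma nested_Suc:
  assumes hom: "\<And>k u v. \<lbrakk>0 \<le> k; 0 \<le> u; 0 \<le> v\<rbrakk> \<Longrightarrow> \<Phi> (k * u) (k * v) = k * \<Phi> u v"
    and "0 \<le> \<alpha>"
  shows "nested \<Phi> \<alpha> (Suc p) = \<Phi> 1 (\<alpha> * nested \<Phi> \<alpha> p)"
proof -
  \<comment> \<open>The outermost \<open>\<Phi>\<close> belongs to the head of the list, so the
    interval is split at its left end, whereas \<open>upt_Suc\<close> would split off the last
    index.\<close>
  have "[0..<Suc p] = 0 # map Suc [0..<p]"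
    by (simp add: upt_conv_Cons map_Suc_upt del: upt_Suc)
  then have "nested \<Phi> \<alpha> (Suc p) = \<Phi> 1 (foldr (\<lambda>i. \<Phi> (\<alpha> * \<alpha> ^ i)) [0..<p] (\<alpha> * \<alpha> ^ p))"
    by (simp add: nested_def foldr_map comp_def del: upt_Suc)
  then show ?thesis
    using foldr_homogeneous[OF hom, of "\<lambda>i. \<alpha> ^ i" "\<alpha> ^ p" \<alpha> "[0..<p]"] \<open>0 \<le> \<alpha>\<close>
    by (simp add: nested_def)
qed

lemma dist_le_nested:
  assumes hom: "\<And>k u v. \<lbrakk>0 \<le> k; 0 \<le> u; 0 \<le> v\<rbrakk> \<Longrightarrow> \<Phi> (k * u) (k * v) = k * \<Phi> u v"
    and X: "\<And>n. x n \<in> X"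
    and "0 \<le> \<alpha>"
    and contr: "\<And>n. d (x (Suc n)) (x (Suc (Suc n))) \<le> \<alpha> * d (x n) (x (Suc n))"
  shows "d (x n) (x (Suc (n + p))) \<le> \<alpha> ^ n * d (x 0) (x 1) * nested \<Phi> \<alpha> p"
proof -
  have D: "0 \<le> d (x 0) (x 1)"
    by (simp add: X nonneg)
  have step: "d (x n) (x (Suc n)) \<le> \<alpha> ^ n * d (x 0) (x 1)" for n
  proof (induction n)
    case (Suc n)
    show ?case
      using order_trans[OF contr mult_left_mono[OF Suc \<open>0 \<le> \<alpha>\<close>]] by (simp add: mult.assoc)
  qed simp
  show ?thesis
  proof (induction p arbitrary: n)
    \<comment> \<open>Here \<open>nested \<Phi> \<alpha> 0\<close> is just \<alpha>^0 = 1, which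
      leaves the geometric decay of consecutive distances.\<close>
    case 0
    show ?case
      using step by (simp add: nested_def)
  next
    case (Suc p)
    let ?c = "\<alpha> ^ n * d (x 0) (x 1)"
    have c: "0 \<le> ?c" using \<open>0 \<le> \<alpha>\<close> D by simp
    \<comment> \<open>The induction hypothesis is taken at n + 1. Its extra factor \<alpha> is moved
      next to the nested term, so that \<open>?c\<close> can be pulled out of both arguments of
      \<open>\<Phi>\<close> and \<open>nested_Suc\<close> applies.\<close>
    have IH: "d (x (Suc n)) (x (Suc (n + Suc p))) \<le> ?c * (\<alpha> * nested \<Phi> \<alpha> p)"
      using Suc[of "Suc n"] by (simp add: ac_simps)
    have "d (x n) (x (Suc (n + Suc p)))
        \<le> \<Phi> (d (x n) (x (Suc n))) (d (x (Suc n)) (x (Suc (n + Suc p))))"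
      by (rule triangle) (simp_all add: X)
    also have "\<dots> \<le> \<Phi> ?c (d (x (Suc n)) (x (Suc (n + Suc p))))"
      by (intro mono_left step nonneg X)
    also have "\<dots> \<le> \<Phi> ?c (?c * (\<alpha> * nested \<Phi> \<alpha> p))"
      by (intro mono_right IH c nonneg X)
    also have "\<dots> = ?c * nested \<Phi> \<alpha> (Suc p)"
      using hom[OF c, of 1 "\<alpha> * nested \<Phi> \<alpha> p"] nested_Suc[OF hom \<open>0 \<le> \<alpha>\<close>]
        nested_nonneg[OF \<open>0 \<le> \<alpha>\<close>] \<open>0 \<le> \<alpha>\<close>
      by simp
    finally show ?case .
  qed
qed

end

text \<open>A bound uniform in p replaces the usual triangle inequality argument: it controls all
  later terms at once, and symmetry covers the opposite order of indices.\<close>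

lemma (in semimetric_space) semimetric_CauchyI_decay:
  assumes X: "\<And>n. x n \<in> X"
    and "b \<longlonglongrightarrow> (0::real)"
    and le: "\<And>n p. d (x n) (x (Suc (n + p))) \<le> b n"
  shows "semimetric_Cauchy d x"
  unfolding semimetric_Cauchy_def
proof (intro allI impI)
  fix \<epsilon> :: real
  assume "0 < \<epsilon>"
  then obtain N where N: "\<And>n. n \<ge> N \<Longrightarrow> b n < \<epsilon>"
    using order_tendstoD(2)[OF \<open>b \<longlonglongrightarrow> 0\<close>] by (auto simp: eventually_sequentially)
  have *: "d (x n) (x m) < \<epsilon>" if "N \<le> n" "n < m" for n m
  proof -
    obtain p where "m = Suc (n + p)"
      using \<open>n < m\<close> less_iff_Suc_add by blast
    then show ?thesis
      using le[of n p] N[OF \<open>N \<le> n\<close>] by simp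
  qed
  have "d (x n) (x m) < \<epsilon>" if "n \<ge> N" "m \<ge> N" for n m
  proof (cases n m rule: linorder_cases)
    case less
    then show ?thesis using * that by blast
  next
    case equal
    then show ?thesis using zero_iff[OF X X, of n m] \<open>0 < \<epsilon>\<close> by simp
  next
    case greater
    then show ?thesis using *[of m n] that commute[OF X X, of n m] by simp
  qed
  then show "\<exists>N. \<forall>n\<ge>N. \<forall>m\<ge>N. d (x n) (x m) < \<epsilon>"
    by blast
qed

theorem lemma1p2:
  fixes X :: "'a set" and d :: "'a \<Rightarrow> 'a \<Rightarrow> real"
    and \<Phi> :: "real \<Rightarrow> real \<Rightarrow> real" and x :: "nat \<Rightarrow> 'a"
  assumes "semimetric_space X d"
    and "triangle_function X d \<Phi>"
    and "\<forall>k u v. 0 \<le> k \<longrightarrow> 0 \<le> u \<longrightarrow> 0 \<le> v \<longrightarrow> \<Phi> (k * u) (k * v) = k * \<Phi> u v"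
    and "\<forall>\<alpha>. 0 \<le> \<alpha> \<and> \<alpha> < 1 \<longrightarrow> (\<exists>C>0. \<forall>p\<ge>1. nested \<Phi> \<alpha> p \<le> C)"
    and "range x \<subseteq> X"
    and "\<exists>\<alpha>. 0 \<le> \<alpha> \<and> \<alpha> < 1 \<and> (\<forall>n\<ge>1. d (x n) (x (n + 1)) \<le> \<alpha> * d (x (n - 1)) (x n))"
  shows "semimetric_Cauchy d x"
proof -
  interpret triangle_function X d \<Phi> by fact
  have X: "x n \<in> X" for n
    using assms(5) by blast
  have hom: "\<Phi> (k * u) (k * v) = k * \<Phi> u v" if "0 \<le> k" "0 \<le> u" "0 \<le> v" for k u v
    using assms(3) that by blast
  obtain \<alpha> where \<alpha>: "0 \<le> \<alpha>" "\<alpha> < 1"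
    and contr: "\<And>n. n \<ge> 1 \<Longrightarrow> d (x n) (x (n + 1)) \<le> \<alpha> * d (x (n - 1)) (x n)"
    using assms(6) by blast
  obtain C where C: "\<And>p. p \<ge> 1 \<Longrightarrow> nested \<Phi> \<alpha> p \<le> C"
    using assms(4) \<alpha> by blast
  \<comment> \<open>The assumed bound starts at p = 1; the maximum with 1 accounts for p = 0, where
    the nested expression equals 1.\<close>
  have bound: "nested \<Phi> \<alpha> p \<le> max 1 C" for p
    using C[of p] by (cases p) (auto simp: nested_def)
  have "d (x n) (x (Suc (n + p))) \<le> \<alpha> ^ n * d (x 0) (x 1) * max 1 C" for n p
  proof -
    have "d (x n) (x (Suc (n + p))) \<le> \<alpha> ^ n * d (x 0) (x 1) * nested \<Phi> \<alpha> p"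
      \<comment> \<open>Instantiating at a successor removes the side condition n \<ge> 1 and the
        subtraction n - 1.\<close>
      using contr[of "Suc _"] by (intro dist_le_nested hom X \<alpha>) simp_all
    also have "\<dots> \<le> \<alpha> ^ n * d (x 0) (x 1) * max 1 C"
      using \<alpha> by (intro mult_left_mono bound mult_nonneg_nonneg nonneg X) simp_all
    finally show ?thesis .
  qed
  moreover have "(\<lambda>n. \<alpha> ^ n * d (x 0) (x 1) * max 1 C) \<longlonglongrightarrow> 0"
    using \<alpha> by (intro tendsto_mult_left_zero LIMSEQ_realpow_zero)
  ultimately show ?thesis
    using semimetric_CauchyI_decay[of x] X by blast
qed

end
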